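(* Let $M$ be a simple matroid of rank $3$ on $E$ and let $E=E_1\cup E_2\cup E_3$ be a partition of the points of the geometric representation of $M$ such that 1) $r(M|_{E_i})\ge 2$ for each $i=1,2,3$; 2) for each line $l$ with at least $3$ points of $M$: a) if $l\cap E_1\neq\emptyset$, then $|l\cap(E_2\cup E_3)|\le 1$; b) if $l\cap E_3\neq\emptyset$, then $|l\cap(E_1\cup E_2)|\le 1$. Then $E=E_1\cup E_2\cup E_3$ is a good $3$-partition of $M$.
   Context: A rank-$3$ matroid is represented geometrically by points in the plane, one for each element, together with (possibly curved) lines, any two of which meet in at most one point; the bases are the $3$-subsets of points that are not collinear. The lines of $M$ are the lines of this diagram (i.e. the rank-$2$ flats of $M$), regarded as sets of points. $r(\cdot)$ denotes rank, $M|_A$ the restriction to $A$, and $\mathcal{I}(\cdot)$ the family of independent sets. Good $3$-partition: for a matroid $M$ on $E$ of rank $r\ge 3$, a partition $E=E_1\cup E_2\cup E_3$ with $r_i=r(M|_{E_i})>1$ for all $i$ is a good $3$-partition if there exist integers $0<a_i<r_i$ ($i=1,2,3$) such that: (P1) $r=a_1+a_2+a_3$; (P2)(a) if $X\in\mathcal{I}(M|_{E_1})$ with $|X|\le a_1$ and $Y\in\mathcal{I}(M|_{E_2\cup E_3})$ with $|Y|\le a_2+a_3$, then $X\cup Y\in\mathcal{I}(M)$; and if $X\in\mathcal{I}(M|_{E_1\cup E_2})$ with $|X|\le a_1+a_2$ and $Y\in\mathcal{I}(M|_{E_3})$ with $|Y|\le a_3$, then $X\cup Y\in\mathcal{I}(M)$;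 (P2)(b) if $X\in\mathcal{I}(M|_{E_1})$ with $|X|\le a_1$, $Y\in\mathcal{I}(M|_{E_2})$ with $|Y|\le a_2$, and $Z\in\mathcal{I}(M|_{E_3})$ with $|Z|\le a_3$, then $X\cup Y\cup Z\in\mathcal{I}(M)$. *)

theory Defs
  imports Main
begin

record 'a set_system =
  ground :: "'a set"
  indeps :: "'a set set"

locale matroid =
  fixes M :: "'a set_system"
  assumes finite_ground: "finite (ground M)"
    and indeps_subset_ground: "X \<in> indeps M \<Longrightarrow> X \<subseteq> ground M"
    and empty_indep: "{} \<in> indeps M"
    and indep_mono: "\<lbrakk>X \<in> indeps M; Y \<subseteq> X\<rbrakk> \<Longrightarrow> Y \<in> indeps M"
    and augment: "\<lbrakk>X \<in> indeps M; Y \<in> indeps M; card X < card Y\<rbrakk>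
      \<Longrightarrow> \<exists>y \<in> Y - X. insert y X \<in> indeps M"

definition restriction :: "'a set_system \<Rightarrow> 'a set \<Rightarrow> 'a set_system" where
  "restriction M A = \<lparr>ground = A, indeps = {X \<in> indeps M. X \<subseteq> A}\<rparr>"

lemma (in matroid) matroid_restriction:
  assumes "A \<subseteq> ground M"
  shows "matroid (restriction M A)"
proof
  show "finite (ground (restriction M A))"
    using assms finite_ground by (auto simp: restriction_def intro: finite_subset)
  show "\<exists>y \<in> Y - X. insert y X \<in> indeps (restriction M A)"
    if "X \<in> indeps (restriction M A)" "Y \<in> indeps (restriction M A)" "card X < card Y" for X Y
    using that augment[of X Y] by (auto simp: restriction_def)
qed (auto simp: restriction_def empty_indep intro: indep_mono)

definition rank :: "'a set_system \<Rightarrow> nat" where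
  "rank M = Max (card ` indeps M)"

definition circuit :: "'a set_system \<Rightarrow> 'a set \<Rightarrow> bool" where
  "circuit M C \<longleftrightarrow> C \<subseteq> ground M \<and> C \<notin> indeps M \<and> (\<forall>D. D \<subset> C \<longrightarrow> D \<in> indeps M)"

definition simple_matroid :: "'a set_system \<Rightarrow> bool" where
  "simple_matroid M \<longleftrightarrow> matroid M
    \<and> (\<forall>e. \<not> circuit M {e}) \<and> (\<forall>e f. e \<noteq> f \<longrightarrow> \<not> circuit M {e, f})"

definition flat :: "'a set_system \<Rightarrow> 'a set \<Rightarrow> bool" where
  "flat M F \<longleftrightarrow> F \<subseteq> ground M
    \<and> (\<forall>e \<in> ground M - F. rank (restriction M F) < rank (restriction M (insert e F)))"

definition line :: "'a set_system \<Rightarrow> 'a set \<Rightarrow> bool" where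
  "line M l \<longleftrightarrow> flat M l \<and> rank (restriction M l) = 2"

text \<open>The blocks of a 3-partition need not be required nonempty: wherever this
  is used, each block is also required to have rank at least 2.\<close>

definition partition3 :: "'a set \<Rightarrow> 'a set \<Rightarrow> 'a set \<Rightarrow> 'a set \<Rightarrow> bool" where
  "partition3 E E1 E2 E3 \<longleftrightarrow> E = E1 \<union> E2 \<union> E3
    \<and> E1 \<inter> E2 = {} \<and> E1 \<inter> E3 = {} \<and> E2 \<inter> E3 = {}"

definition good_3_partition ::
    "'a set_system \<Rightarrow> 'a set \<Rightarrow> 'a set \<Rightarrow> 'a set \<Rightarrow> bool" where
  "good_3_partition M E1 E2 E3 \<longleftrightarrow>
    matroid M \<and> rank M \<ge> 3 \<and> partition3 (ground M) E1 E2 E3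
    \<and> rank (restriction M E1) > 1 \<and> rank (restriction M E2) > 1 \<and> rank (restriction M E3) > 1
    \<and> (\<exists>a1 a2 a3 :: nat.
        0 < a1 \<and> a1 < rank (restriction M E1)
      \<and> 0 < a2 \<and> a2 < rank (restriction M E2)
      \<and> 0 < a3 \<and> a3 < rank (restriction M E3)
      \<and> rank M = a1 + a2 + a3
      \<and> (\<forall>X \<in> indeps (restriction M E1). \<forall>Y \<in> indeps (restriction M (E2 \<union> E3)).
            card X \<le> a1 \<and> card Y \<le> a2 + a3 \<longrightarrow> X \<union> Y \<in> indeps M)
      \<and> (\<forall>X \<in> indeps (restriction M (E1 \<union> E2)). \<forall>Y \<in> indeps (restriction M E3).
            card X \<le> a1 + a2 \<and> card Y \<le> a3 \<longrightarrow> X \<union> Y \<in> indeps M)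
      \<and> (\<forall>X \<in> indeps (restriction M E1). \<forall>Y \<in> indeps (restriction M E2).
            \<forall>Z \<in> indeps (restriction M E3).
            card X \<le> a1 \<and> card Y \<le> a2 \<and> card Z \<le> a3 \<longrightarrow> X \<union> Y \<union> Z \<in> indeps M))"

end

theory Submission
  imports Defs
begin

text \<open>
  The partition is good with \<open>a\<^sub>1 = a\<^sub>2 = a\<^sub>3 = 1\<close>: these values sum to the rank 3, and each is
  below the rank of its block because that rank is at least 2. Every remaining condition then asks
  that a union of at most three points be independent. A simple matroid has all sets of at most
  two points independent, so a split into two sides can only fail through a point of \<open>E\<^sub>1\<close>
  collinear with two points of \<open>E\<^sub>2 \<union> E\<^sub>3\<close> (or, symmetrically, a point of \<open>E\<^sub>3\<close> collinear with two
  points of \<open>E\<^sub>1 \<union> E\<^sub>2\<close>). The line through those points would have at least three points, meet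
  \<open>E\<^sub>1\<close>, and contain two points of \<open>E\<^sub>2 \<union> E\<^sub>3\<close>, which is exactly what the hypothesis on lines
  forbids. The condition on all three blocks reduces to the split \<open>E\<^sub>1\<close>, \<open>E\<^sub>2 \<union> E\<^sub>3\<close>, since at most
  one point from each of \<open>E\<^sub>2\<close> and \<open>E\<^sub>3\<close> always gives an independent set.

  Two facts carry the argument: the span of an independent set is a flat whose rank is the size
  of the set, which supplies the line (\<open>flat_span\<close>, \<open>rank_span\<close>); and the independence statement
  for a single pair of disjoint sets (\<open>separated_Un_indep\<close>), applied to both splits.
\<close>

context matroid
begin

lemma finite_indeps_restriction: "finite (indeps (restriction M A))"
proof (rule finite_subset)
  show "indeps (restriction M A) \<subseteq> Pow (ground M)"
    by (auto simp: restriction_def dest: indeps_subset_ground)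
qed (simp add: finite_ground)

lemma card_le_rank_restriction:
  assumes "X \<in> indeps M" "X \<subseteq> A"
  shows "card X \<le> rank (restriction M A)"
  unfolding rank_def
  by (rule Max_ge) (use assms finite_indeps_restriction in \<open>auto simp: restriction_def\<close>)

lemma rank_restriction_leI:
  assumes "\<And>X. X \<in> indeps M \<Longrightarrow> X \<subseteq> A \<Longrightarrow> card X \<le> n"
  shows "rank (restriction M A) \<le> n"
proof -
  have "{} \<in> indeps (restriction M A)"
    by (simp add: restriction_def empty_indep)
  then show ?thesis
    unfolding rank_def using assms finite_indeps_restriction[of A]
    by (subst Max_le_iff) (auto simp: restriction_def)
qed

text \<open>
  For an independent set \<open>B\<close> this is the matroid closure: an element outside \<open>B\<close> depends on \<open>B\<close>
  exactly when adding it destroys independence.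
\<close>

definition span :: "'a set \<Rightarrow> 'a set" where
  "span B = {e \<in> ground M. e \<in> B \<or> insert e B \<notin> indeps M}"

lemma subset_span:
  assumes "B \<in> indeps M"
  shows "B \<subseteq> span B"
  using indeps_subset_ground[OF assms] by (auto simp: span_def)

text \<open>An independent subset of the span larger than \<open>B\<close> would augment \<open>B\<close> within its own span.\<close>

lemma rank_span:
  assumes "B \<in> indeps M"
  shows "rank (restriction M (span B)) = card B"
proof (rule antisym)
  show "rank (restriction M (span B)) \<le> card B"
  proof (rule rank_restriction_leI)
    fix X assume X: "X \<in> indeps M" "X \<subseteq> span B"
    show "card X \<le> card B"
    proof (rule ccontr)
      assume "\<not> card X \<le> card B"
      then obtain y where "y \<in> X - B" "insert y B \<in> indeps M"
        using augment[OF assms X(1)] by auto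
      then show False using X(2) by (auto simp: span_def)
    qed
  qed
  show "card B \<le> rank (restriction M (span B))"
    by (rule card_le_rank_restriction[OF assms subset_span[OF assms]])
qed

lemma flat_span:
  assumes "B \<in> indeps M"
  shows "flat M (span B)"
  unfolding flat_def
proof (intro conjI ballI)
  show "span B \<subseteq> ground M" by (auto simp: span_def)
next
  fix e assume "e \<in> ground M - span B"
  then have e: "e \<notin> B" "insert e B \<in> indeps M"
    by (auto simp: span_def)
  have "finite B"
    using indeps_subset_ground[OF assms] finite_ground by (rule finite_subset)
  then have "rank (restriction M (span B)) < card (insert e B)"
    using e by (simp add: rank_span[OF assms])
  also have "\<dots> \<le> rank (restriction M (insert e (span B)))"
    using subset_span[OF assms] by (intro card_le_rank_restriction[OF e(2)]) auto
  finally show "rank (restriction M (span B)) < rank (restriction M (insert e (span B)))" .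
qed

lemma line_span:
  assumes "B \<in> indeps M" "card B = 2"
  shows "line M (span B)"
  using assms by (simp add: line_def flat_span rank_span)

end

lemma simple_matroid_pair_indep:
  assumes "simple_matroid M" "e \<in> ground M" "f \<in> ground M"
  shows "{e, f} \<in> indeps M"
proof -
  interpret matroid M using assms(1) by (simp add: simple_matroid_def)
  have point: "{g} \<in> indeps M" if "g \<in> ground M" for g
  proof -
    have "\<not> circuit M {g}" using assms(1) by (simp add: simple_matroid_def)
    then show ?thesis
      using that by (auto simp: circuit_def psubset_eq subset_singleton_iff empty_indep)
  qed
  show ?thesis
  proof (cases "e = f")
    case True
    then show ?thesis using point assms(2) by simp
  next
    case False
    then have "\<not> circuit M {e, f}" using assms(1) by (simp add: simple_matroid_def)
    moreover have "D \<in> indeps M" if "D \<subset> {e, f}" for D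
    proof -
      have "D \<subseteq> {e} \<or> D \<subseteq> {f}" using that by auto
      then show ?thesis using indep_mono point assms(2,3) by blast
    qed
    ultimately show ?thesis using assms(2,3) by (auto simp: circuit_def)
  qed
qed

lemma simple_matroid_small_indep:
  assumes "simple_matroid M" "X \<subseteq> ground M" "card X \<le> 2"
  shows "X \<in> indeps M"
proof -
  interpret matroid M using assms(1) by (simp add: simple_matroid_def)
  have "finite X" using assms(2) finite_ground by (rule finite_subset)
  then consider "X = {}" | e where "X = {e}" | e f where "X = {e, f}"
    using assms(3) by (metis card_0_eq card_1_singletonE card_2_iff le_SucE le_zero_eq numeral_2_eq_2
        One_nat_def)
  then show ?thesis
    using simple_matroid_pair_indep[OF assms(1)] assms(2) empty_indep
    by cases (auto, fastforce)
qed

text \<open>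
  If the union were dependent, the point of \<open>X\<close> would lie on the line spanned by the two points
  of \<open>Y\<close>; that line then has at least three points, meets \<open>A\<close>, and has two points in \<open>B\<close>.
\<close>

lemma separated_Un_indep:
  assumes simple: "simple_matroid M"
    and disj: "A \<inter> B = {}"
    and sep: "\<And>l. \<lbrakk>line M l; card l \<ge> 3; l \<inter> A \<noteq> {}\<rbrakk> \<Longrightarrow> card (l \<inter> B) \<le> 1"
    and X: "X \<in> indeps M" "X \<subseteq> A" "card X \<le> 1"
    and Y: "Y \<in> indeps M" "Y \<subseteq> B" "card Y \<le> 2"
  shows "X \<union> Y \<in> indeps M"
proof (rule ccontr)
  assume dep: "X \<union> Y \<notin> indeps M"
  interpret matroid M using simple by (simp add: simple_matroid_def)
  have sub: "X \<subseteq> ground M" "Y \<subseteq> ground M"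
    using X(1) Y(1) by (simp_all add: indeps_subset_ground)
  then have fin: "finite X" "finite Y"
    using finite_ground by (auto intro: finite_subset)
  have "\<not> card (X \<union> Y) \<le> 2"
    using dep simple_matroid_small_indep[OF simple, of "X \<union> Y"] sub by auto
  moreover have "card (X \<union> Y) \<le> card X + card Y" by (rule card_Un_le)
  ultimately have "card X = 1" and Y2: "card Y = 2"
    using X(3) Y(3) by linarith+
  then obtain x where x: "X = {x}" by (auto simp: card_1_singleton_iff)
  have xY: "x \<notin> Y" using x X(2) Y(2) disj by auto
  have x_span: "x \<in> span Y" using dep sub x by (auto simp: span_def)
  have Y_span: "Y \<subseteq> span Y" by (rule subset_span[OF Y(1)])
  have fin_span: "finite (span Y)"
    by (rule finite_subset[OF _ finite_ground]) (auto simp: span_def)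
  have "card (insert x Y) \<le> card (span Y)"
    using x_span Y_span fin_span by (intro card_mono) auto
  then have "3 \<le> card (span Y)" using xY fin Y2 by simp
  then have "card (span Y \<inter> B) \<le> 1"
    using sep[OF line_span[OF Y(1) Y2]] x_span x X(2) by auto
  moreover have "card Y \<le> card (span Y \<inter> B)"
    using Y_span Y(2) fin_span by (intro card_mono) auto
  ultimately show False using Y2 by simp
qed

theorem corollary4:
  fixes M :: "'a set_system" and E1 E2 E3 :: "'a set"
  assumes "simple_matroid M"
    and "rank M = 3"
    and "partition3 (ground M) E1 E2 E3"
    and "rank (restriction M E1) \<ge> 2"
    and "rank (restriction M E2) \<ge> 2"
    and "rank (restriction M E3) \<ge> 2"
    and "\<And>l. \<lbrakk>line M l; card l \<ge> 3; l \<inter> E1 \<noteq> {}\<rbrakk> \<Longrightarrow> card (l \<inter> (E2 \<union> E3)) \<le> 1"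
    and "\<And>l. \<lbrakk>line M l; card l \<ge> 3; l \<inter> E3 \<noteq> {}\<rbrakk> \<Longrightarrow> card (l \<inter> (E1 \<union> E2)) \<le> 1"
  shows "good_3_partition M E1 E2 E3"
proof -
  have M: "matroid M" using assms(1) by (simp add: simple_matroid_def)
  have disj: "E1 \<inter> (E2 \<union> E3) = {}" "E3 \<inter> (E1 \<union> E2) = {}"
    using assms(3) by (auto simp: partition3_def)
  have split_1_23: "X \<union> Y \<in> indeps M"
    if "X \<in> indeps M" "X \<subseteq> E1" "card X \<le> 1" "Y \<in> indeps M" "Y \<subseteq> E2 \<union> E3" "card Y \<le> 2" for X Y
    by (rule separated_Un_indep[OF assms(1) disj(1) assms(7) that])
  have split_12_3: "X \<union> Y \<in> indeps M"
    if "X \<in> indeps M" "X \<subseteq> E1 \<union> E2" "card X \<le> 2" "Y \<in> indeps M" "Y \<subseteq> E3" "card Y \<le> 1" for X Y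
    using separated_Un_indep[OF assms(1) disj(2) assms(8) that(4-6) that(1-3)]
    by (simp add: Un_commute)
  have split_1_2_3: "X \<union> Y \<union> Z \<in> indeps M"
    if X: "X \<in> indeps M" "X \<subseteq> E1" "card X \<le> 1" and Y: "Y \<in> indeps M" "Y \<subseteq> E2" "card Y \<le> 1"
      and Z: "Z \<in> indeps M" "Z \<subseteq> E3" "card Z \<le> 1" for X Y Z
  proof -
    have "Y \<union> Z \<subseteq> ground M"
      using matroid.indeps_subset_ground[OF M] Y(1) Z(1) by blast
    moreover have YZ: "card (Y \<union> Z) \<le> 2"
      using card_Un_le[of Y Z] Y(3) Z(3) by linarith
    ultimately have "Y \<union> Z \<in> indeps M"
      by (rule simple_matroid_small_indep[OF assms(1)])
    moreover have "Y \<union> Z \<subseteq> E2 \<union> E3" using Y(2) Z(2) by blast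
    ultimately have "X \<union> (Y \<union> Z) \<in> indeps M" using YZ by (rule split_1_23[OF X])
    then show ?thesis by (simp add: Un_assoc)
  qed
  show ?thesis
    unfolding good_3_partition_def
  proof (intro conjI exI[of _ "1::nat"])
  qed (use M assms split_1_23 split_12_3 split_1_2_3 in \<open>auto simp: restriction_def numeral_2_eq_2\<close>)
qed

end
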